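(* (1) Let $z,z^*:\mathbb Z^3\to\mathbb C$ satisfy the duality relation $(z_{in}-z_{out})(z^*_{in}-z^*_{out})=\Delta_n$ on every edge $(p_{out},p_{in})$ of type $E_n$, $n=1,2,3$, and let $\mathfrak e_1,\mathfrak e_2,\mathfrak e_3,\mathfrak e_4$ be consecutive positively oriented edges of an elementary quadrilateral of $\mathcal{QL}$. Then the zero curvature condition $$L(\mathfrak e_4,\lambda)L(\mathfrak e_3,\lambda)L(\mathfrak e_2,\lambda)L(\mathfrak e_1,\lambda)=I$$ holds, where for an oriented edge $\mathfrak e=(p_{out},p_{in})$ of type $E_n$ $$L(\mathfrak e,\lambda)=(1-\lambda^2\Delta_n)^{-1/2}\begin{pmatrix}1&\lambda(z_{in}-z_{out})\\ \lambda(z^*_{in}-z^*_{out})&1\end{pmatrix}.$$ (2) Moreover, let elements $$L^{(n)}(\mathfrak e,\lambda)=(1-\lambda^2\Delta_n)^{-1/2}\begin{pmatrix}1&\lambda f\\ \lambda g&1\end{pmatrix},\qquad fg=\Delta_n,\ n=1,2,3,$$ of $G[\lambda]$ (with $f=f(\mathfrak e)$, $g=g(\mathfrak e)$) be attached to the oriented edges $\mathfrak e=(p_{out},p_{in})\in E_n$. Then the zero curvature condition on $\mathbb Z^3$ is equivalent to the existence of $z,z^*:\mathbb Z^3\to\mathbb C$ such that the factorization $$f(\mathfrak e)=z(p_{in})-z(p_{out}),\qquad g(\mathfrak e)=z^*(p_{in})-z^*(p_{out})$$ holds. The so defined $z,z^*$ satisfy the duality relation $(z_{in}-z_{out})(z^*_{in}-z^*_{out})=\Delta_n$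 on edges of type $E_n$ and the cross-ratio equations $$q(z_{k,\ell,m},z_{k+1,\ell,m},z_{k+1,\ell,m-1},z_{k,\ell,m-1})=\tfrac{\Delta_1}{\Delta_3},\quad q(z_{k,\ell,m},z_{k,\ell,m+1},z_{k,\ell-1,m+1},z_{k,\ell-1,m})=\tfrac{\Delta_3}{\Delta_2},$$ $$q(z_{k,\ell,m},z_{k,\ell+1,m},z_{k-1,\ell+1,m},z_{k-1,\ell,m})=\tfrac{\Delta_2}{\Delta_1}.$$
   Context: $\Delta_1,\Delta_2,\Delta_3\in\mathbb C$ are constants. Edges of $\mathbb Z^3$ have types $E_1=(p,p+(1,0,0))$, $E_2=(p,p+(0,1,0))$, $E_3=(p,p+(0,0,1))$, $p\in\mathbb Z^3$; the reversed edge has the same type, and the matrix attached to the reversed edge is the inverse matrix. For an edge $(p_{out},p_{in})$, $z_{out}=z(p_{out})$, $z_{in}=z(p_{in})$, similarly for $z^*$. The quadrilateral lattice $\mathcal{QL}$ is the part $\{(k,\ell,m):|k+\ell+m|\le1\}$ of $\mathbb Z^3$, with the edges of $\mathbb Z^3$ between its vertices; its elementary quadrilaterals are the unit squares of $\mathbb Z^3$ contained in it. Cross-ratio: $q(z_1,z_2,z_3,z_4)=\dfrac{(z_2-z_1)(z_4-z_3)}{(z_3-z_2)(z_1-z_4)}$. The twisted loop group is $G[\lambda]=\{L:\mathbb C\to SL(2,\mathbb C)\mid L(-\lambda)=\sigma_3L(\lambda)\sigma_3\}$, $\sigma_3=\mathrm{diag}(1,-1)$. The zero curvature condition on $\mathbb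 Z^3$ is: for every closed contour of oriented edges $\mathfrak e_1=(p_1,p_2),\dots,\mathfrak e_s=(p_s,p_1)$ the attached matrices satisfy $L(\mathfrak e_s,\lambda)\cdots L(\mathfrak e_1,\lambda)=I$.
   Formalization: Added where duality or factorization is to give zero curvature: z maps no square involved to a parallelogram, unless its cross-ratio is Δ_i/Δ_j with nonzero Δ's. Cross-ratio equations are claimed under zero curvature, for nonzero denominators; λ avoids λ²Δ_n=1. *)

theory Defs
  imports "HOL-Analysis.Analysis"
begin

type_synonym vertex = "int ^ 3"
type_synonym edge = "vertex \<times> vertex"  (* oriented: (p_out, p_in) *)
type_synonym mat2 = "complex ^ 2 ^ 2"

(* Oriented edges of type E_n, in both orientations.
   In the index type 3 the numeral 3 denotes the same element as 0, so 1, 2, 3 are its three elements. *)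
definition edges :: "3 \<Rightarrow> edge set" where
  "edges n = {(p, q). q = p + axis n 1 \<or> p = q + axis n 1}"

definition reverse :: "edge \<Rightarrow> edge" where
  "reverse e = (snd e, fst e)"

definition QL :: "vertex set" where
  "QL = {p. \<bar>p $ 1 + p $ 2 + p $ 3\<bar> \<le> 1}"

(* The vertices of a unit square in cyclic order. Any starting vertex and both senses of traversal are
   allowed: the opposite edges (p1,p2), (p3,p4) have type i, the other two have type j. *)
definition unit_square :: "3 \<Rightarrow> 3 \<Rightarrow> vertex \<Rightarrow> vertex \<Rightarrow> vertex \<Rightarrow> vertex \<Rightarrow> bool" where
  "unit_square i j p1 p2 p3 p4 \<longleftrightarrow>
     i \<noteq> j \<and> (p1, p2) \<in> edges i \<and> (p2, p3) \<in> edges j \<and> p4 = p1 + p3 - p2"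

definition cross_ratio :: "complex \<Rightarrow> complex \<Rightarrow> complex \<Rightarrow> complex \<Rightarrow> complex" where
  "cross_ratio z1 z2 z3 z4 = ((z2 - z1) * (z4 - z3)) / ((z3 - z2) * (z1 - z4))"

definition duality :: "(3 \<Rightarrow> complex) \<Rightarrow> (vertex \<Rightarrow> complex) \<Rightarrow> (vertex \<Rightarrow> complex) \<Rightarrow> bool" where
  "duality \<Delta> z zs \<longleftrightarrow>
     (\<forall>n. \<forall>(p_out, p_in) \<in> edges n. (z p_in - z p_out) * (zs p_in - zs p_out) = \<Delta> n)"

(* The spectral parameters at which the matrices on edges of type E_n, with d = Delta_n, are defined. *)
definition regular_params :: "complex \<Rightarrow> complex set" where
  "regular_params d = {lam. lam\<^sup>2 * d \<noteq> 1}"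

(* The root is the principal branch, a function of 1 - lambda^2 d only, hence even in lambda. *)
definition lax_matrix :: "complex \<Rightarrow> complex \<Rightarrow> complex \<Rightarrow> complex \<Rightarrow> mat2" where
  "lax_matrix d f g lam =
     (let c = (1 - lam\<^sup>2 * d) powr (- 1 / 2)
      in vector [vector [c * 1, c * (lam * f)],
                 vector [c * (lam * g), c * 1]])"

definition sigma3 :: mat2 where
  "sigma3 = vector [vector [1, 0], vector [0, -1]]"

(* The twisted loop group, for loops defined on the parameter set D only; the normalising factor
   (1 - lambda^2 Delta_n)^(-1/2) of the matrices used here has singularities if Delta_n is not 0. *)
definition twisted_loop_group :: "complex set \<Rightarrow> (complex \<Rightarrow> mat2) set" where
  "twisted_loop_group D =
     {L. (\<forall>lam\<in>D. det (L lam) = 1) \<and> (\<forall>lam\<in>D. L (- lam) = sigma3 ** L lam ** sigma3)}"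

definition attached :: "(3 \<Rightarrow> complex) \<Rightarrow> (edge \<Rightarrow> complex) \<Rightarrow> (edge \<Rightarrow> complex)
    \<Rightarrow> (edge \<Rightarrow> complex \<Rightarrow> mat2) \<Rightarrow> bool" where
  "attached \<Delta> f g L \<longleftrightarrow>
     (\<forall>n. \<forall>e \<in> edges n.
        f e * g e = \<Delta> n \<and>
        L e \<in> twisted_loop_group (regular_params (\<Delta> n)) \<and>
        (\<forall>lam \<in> regular_params (\<Delta> n).
           L e lam = lax_matrix (\<Delta> n) (f e) (g e) lam \<and>
           L (reverse e) lam = matrix_inv (L e lam)))"

definition closed_contour :: "edge list \<Rightarrow> bool" where
  "closed_contour es \<longleftrightarrow>
     es \<noteq> [] \<and> (\<forall>e \<in> set es. \<exists>n. e \<in> edges n) \<and>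
     (\<forall>i < length es. snd (es ! i) = fst (es ! ((i + 1) mod length es)))"

(* L(e_s) ** ... ** L(e_1) for the list [e_1, ..., e_s] *)
definition contour_product :: "(edge \<Rightarrow> complex \<Rightarrow> mat2) \<Rightarrow> complex \<Rightarrow> edge list \<Rightarrow> mat2" where
  "contour_product L lam es = fold (\<lambda>e A. L e lam ** A) es (mat 1)"

(* For each contour, lambda ranges over the parameters at which all of its matrices are defined. *)
definition zero_curvature :: "(3 \<Rightarrow> complex) \<Rightarrow> (edge \<Rightarrow> complex \<Rightarrow> mat2) \<Rightarrow> bool" where
  "zero_curvature \<Delta> L \<longleftrightarrow>
     (\<forall>es. closed_contour es \<longrightarrow>
        (\<forall>lam. (\<forall>n. \<forall>e \<in> set es. e \<in> edges n \<longrightarrow> lam \<in> regular_params (\<Delta> n)) \<longrightarrow>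
             contour_product L lam es = mat 1))"

definition factorizes :: "(edge \<Rightarrow> complex) \<Rightarrow> (edge \<Rightarrow> complex)
    \<Rightarrow> (vertex \<Rightarrow> complex) \<Rightarrow> (vertex \<Rightarrow> complex) \<Rightarrow> bool" where
  "factorizes f g z zs \<longleftrightarrow>
     (\<forall>n. \<forall>(p_out, p_in) \<in> edges n.
        f (p_out, p_in) = z p_in - z p_out \<and> g (p_out, p_in) = zs p_in - zs p_out)"

(* The passage from the duality relation to zero curvature divides by z1 - z2 + z3 - z4, so it needs a
   condition on the squares that z maps to parallelograms. Without one it is false:
   z(k,l,m) = k + 2l + m, z*(k,l,m) = k + l/2 + m is dual with Delta_1 = Delta_2 = Delta_3 = 1, but the
   matrices on edges of types 1 and 2 do not commute. A parallelogram is therefore required to have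
   the right cross-ratio; for nonzero Delta's this is also necessary for zero curvature. *)
definition nondegenerate_at :: "(3 \<Rightarrow> complex) \<Rightarrow> (vertex \<Rightarrow> complex) \<Rightarrow> 3 \<Rightarrow> 3
    \<Rightarrow> vertex \<Rightarrow> vertex \<Rightarrow> vertex \<Rightarrow> vertex \<Rightarrow> bool" where
  "nondegenerate_at \<Delta> z i j p1 p2 p3 p4 \<longleftrightarrow>
     z p1 - z p2 + z p3 - z p4 \<noteq> 0 \<or>
     (\<Delta> i \<noteq> 0 \<and> \<Delta> j \<noteq> 0 \<and> cross_ratio (z p1) (z p2) (z p3) (z p4) = \<Delta> i / \<Delta> j)"

definition nondegenerate :: "(3 \<Rightarrow> complex) \<Rightarrow> (vertex \<Rightarrow> complex) \<Rightarrow> bool" where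
  "nondegenerate \<Delta> z \<longleftrightarrow>
     (\<forall>i j p1 p2 p3 p4. unit_square i j p1 p2 p3 p4 \<longrightarrow> nondegenerate_at \<Delta> z i j p1 p2 p3 p4)"

(* A quotient of the Delta's is only meaningful for a nonzero denominator. *)
definition cross_ratio_equations :: "(3 \<Rightarrow> complex) \<Rightarrow> (vertex \<Rightarrow> complex) \<Rightarrow> bool" where
  "cross_ratio_equations \<Delta> z \<longleftrightarrow>
     (\<forall>k l m.
        (\<Delta> 3 \<noteq> 0 \<longrightarrow>
          cross_ratio (z (vector [k, l, m])) (z (vector [k + 1, l, m]))
            (z (vector [k + 1, l, m - 1])) (z (vector [k, l, m - 1])) = \<Delta> 1 / \<Delta> 3) \<and>
        (\<Delta> 2 \<noteq> 0 \<longrightarrow>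
          cross_ratio (z (vector [k, l, m])) (z (vector [k, l, m + 1]))
            (z (vector [k, l - 1, m + 1])) (z (vector [k, l - 1, m])) = \<Delta> 3 / \<Delta> 2) \<and>
        (\<Delta> 1 \<noteq> 0 \<longrightarrow>
          cross_ratio (z (vector [k, l, m])) (z (vector [k, l + 1, m]))
            (z (vector [k - 1, l + 1, m])) (z (vector [k - 1, l, m])) = \<Delta> 2 / \<Delta> 1))"

end

theory Submission
  imports Defs
begin

text \<open>
  Write \<open>a, b, c, d\<close> for the increments of \<open>z\<close> along the four consecutive edges of a square and
  \<open>a', b', c', d'\<close> for those of \<open>z\<^sup>*\<close>. A Lax matrix with entries \<open>f, g\<close> is inverted by changing the
  signs of \<open>f\<close> and \<open>g\<close>, so the product around the square is trivial iff
  \<open>L(b) L(a) = L(-c) L(-d)\<close>. Opposite edges have the same type, so the normalising factors cancel, and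
  comparing coefficients of \<open>\<lambda>\<close> (\<open>lax_matrix_closed_iff\<close>) leaves, for every \<open>\<lambda> \<noteq> 0\<close>, the linear
  conditions \<open>a + b + c + d = 0\<close>, \<open>a' + b' + c' + d' = 0\<close> and the quadratic ones
  \<open>b a' = c d'\<close>, \<open>b' a = c' d\<close>. Everything is read off from these four equations.

  If the increments come from functions \<open>z, z\<^sup>*\<close>, the linear conditions are automatic, and duality
  yields the quadratic ones on nondegenerate squares (\<open>dual_quadrilateral\<close>). This is the first part
  of the theorem. Conversely, flatness at one nonzero \<open>\<lambda>\<close> gives the linear conditions, which say
  that \<open>f\<close> and \<open>g\<close> are closed discrete 1-forms, and the quadratic ones, which turn with
  \<open>a a' = \<Delta>\<^sub>i\<close>, \<open>d d' = \<Delta>\<^sub>j\<close> into the cross-ratio equation \<open>a c \<Delta>\<^sub>j = b d \<Delta>\<^sub>i\<close>.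

  Both directions of the equivalence need a passage from squares to the whole lattice. It is the same
  statement twice, the discrete Poincare lemma \<open>flat_transport_exists\<close>: bijections attached to the
  edges that commute around squares have a global parallel section. Applied to translations of
  \<open>\<complex> \<times> \<complex>\<close>, it integrates \<open>(f, g)\<close> to \<open>(z, z\<^sup>*)\<close>. Applied to left multiplication by the Lax matrices,
  it gives a frame \<open>\<Phi>\<close> with \<open>\<Phi>(q) = L(p, q) \<Phi>(p)\<close>, so that the product along any contour telescopes.
\<close>

section \<open>The algebra of a single quadrilateral\<close>

lemma mat2_mult:
  "(vector [vector [a, b], vector [c, d]] :: mat2) ** (vector [vector [a', b'], vector [c', d']] :: mat2)
     = vector [vector [a * a' + b * c', a * b' + b * d'], vector [c * a' + d * c', c * b' + d * d']]"
  by (simp add: vec_eq_iff forall_2 sum_2 matrix_matrix_mult_def)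

lemma mat2_one: "(mat 1 :: mat2) = vector [vector [1, 0], vector [0, 1]]"
  by (simp add: vec_eq_iff forall_2 mat_def)

lemma mat2_eq_iff:
  "(vector [vector [a, b], vector [c, d]] :: mat2) = vector [vector [a', b'], vector [c', d']]
     \<longleftrightarrow> a = a' \<and> b = b' \<and> c = c' \<and> d = d'"
  by (simp add: vec_eq_iff forall_2)

lemma normalisation_nonzero:
  assumes "lam \<in> regular_params d"
  shows "(1 - lam\<^sup>2 * d) powr (- 1 / 2) \<noteq> 0"
  using assms by (auto simp: regular_params_def)

lemma normalisation_square:
  assumes "lam \<in> regular_params d"
  shows "(1 - lam\<^sup>2 * d) powr (- 1 / 2) * (1 - lam\<^sup>2 * d) powr (- 1 / 2) * (1 - lam\<^sup>2 * d) = 1"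
proof -
  have nz: "1 - lam\<^sup>2 * d \<noteq> 0"
    using assms by (auto simp: regular_params_def)
  have "(1 - lam\<^sup>2 * d) powr (- 1 / 2) * (1 - lam\<^sup>2 * d) powr (- 1 / 2)
        = (1 - lam\<^sup>2 * d) powr (- 1 / 2 + - 1 / 2)"
    by (rule powr_add [symmetric])
  also have "\<dots> = inverse (1 - lam\<^sup>2 * d)"
    using nz by (simp add: powr_minus)
  finally show ?thesis
    using nz by simp
qed

lemma lax_matrix_inverse:
  assumes "lam \<in> regular_params d" "f * g = d"
  shows "lax_matrix d (- f) (- g) lam ** lax_matrix d f g lam = mat 1"
proof -
  define c where "c = (1 - lam\<^sup>2 * d) powr (- 1 / 2)"
  have c: "c * c * (1 - lam\<^sup>2 * (f * g)) = 1"
    using normalisation_square [OF assms(1)] assms(2) by (simp add: c_def)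
  show ?thesis
    using c
    unfolding lax_matrix_def Let_def c_def [symmetric] mat2_mult mat2_one mat2_eq_iff
    by (simp add: algebra_simps power2_eq_square)
qed

lemma lax_matrix_inverse':
  assumes "lam \<in> regular_params d" "f * g = d"
  shows "lax_matrix d f g lam ** lax_matrix d (- f) (- g) lam = mat 1"
  using lax_matrix_inverse [of lam d "- f" "- g"] assms by simp

lemma lax_matrix_eq_iff:
  assumes "lam \<in> regular_params d" "lam \<noteq> 0"
  shows "lax_matrix d f g lam = lax_matrix d f' g' lam \<longleftrightarrow> f = f' \<and> g = g'"
  using normalisation_nonzero [OF assms(1)] assms(2)
  unfolding lax_matrix_def Let_def mat2_eq_iff by auto

text \<open>
  Both products carry the same nonzero scalar, one normalising factor per type. Up to that scalar the
  entries are \<open>1 + \<lambda>\<^sup>2 b a'\<close> and \<open>1 + \<lambda>\<^sup>2 b' a\<close> on the diagonal and \<open>\<lambda> (a + b)\<close> and \<open>\<lambda> (a' + b')\<close>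
  off it.
\<close>

lemma lax_matrix_commute_iff:
  assumes "lam \<in> regular_params \<alpha>" "lam \<in> regular_params \<beta>"
  shows "lax_matrix \<beta> b b' lam ** lax_matrix \<alpha> a a' lam
           = lax_matrix \<alpha> c c' lam ** lax_matrix \<beta> d d' lam
     \<longleftrightarrow> lam = 0 \<or> (a + b = c + d \<and> a' + b' = c' + d' \<and> b * a' = c * d' \<and> b' * a = c' * d)"
proof -
  define r s where "r = (1 - lam\<^sup>2 * \<alpha>) powr (- 1 / 2)" and "s = (1 - lam\<^sup>2 * \<beta>) powr (- 1 / 2)"
  have nz: "r * s \<noteq> 0"
    using normalisation_nonzero assms by (simp add: r_def s_def)
  have scale: "lax_matrix \<beta> b b' lam ** lax_matrix \<alpha> a a' lam
     = vector [vector [(r * s) * (1 + lam * lam * (b * a')), (r * s) * (lam * (a + b))],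
               vector [(r * s) * (lam * (a' + b')), (r * s) * (1 + lam * lam * (b' * a))]]"
    for a a' b b'
    unfolding lax_matrix_def Let_def r_def [symmetric] s_def [symmetric] mat2_mult mat2_eq_iff
    by (simp add: algebra_simps)
  have scale': "lax_matrix \<alpha> c c' lam ** lax_matrix \<beta> d d' lam
     = vector [vector [(r * s) * (1 + lam * lam * (c * d')), (r * s) * (lam * (c + d))],
               vector [(r * s) * (lam * (c' + d')), (r * s) * (1 + lam * lam * (c' * d))]]"
    unfolding lax_matrix_def Let_def r_def [symmetric] s_def [symmetric] mat2_mult mat2_eq_iff
    by (simp add: algebra_simps)
  show ?thesis
    unfolding scale scale' mat2_eq_iff mult_cancel_left using nz by auto
qed

text \<open>
  Moving the last two factors to the other side negates \<open>c, c', d, d'\<close>. The signs survive in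
  the linear conditions and cancel in the quadratic ones.
\<close>

lemma lax_matrix_closed_iff:
  assumes reg: "lam \<in> regular_params \<alpha>" "lam \<in> regular_params \<beta>"
    and c: "c * c' = \<alpha>" and d: "d * d' = \<beta>"
  shows "lax_matrix \<beta> d d' lam ** lax_matrix \<alpha> c c' lam ** lax_matrix \<beta> b b' lam ** lax_matrix \<alpha> a a' lam
           = mat 1
     \<longleftrightarrow> lam = 0 \<or> (a + b + c + d = 0 \<and> a' + b' + c' + d' = 0 \<and> b * a' = c * d' \<and> b' * a = c' * d)"
    (is "?D ** ?C ** ?B ** ?A = _ \<longleftrightarrow> _")
proof -
  let ?C' = "lax_matrix \<alpha> (- c) (- c') lam" and ?D' = "lax_matrix \<beta> (- d) (- d') lam"
  note inv = lax_matrix_inverse [OF reg(1) c] lax_matrix_inverse [OF reg(2) d]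
    lax_matrix_inverse' [OF reg(1) c] lax_matrix_inverse' [OF reg(2) d]
  have cancel: "?C' ** (?D' ** (?D ** ?C ** X)) = X" "?D ** ?C ** (?C' ** ?D') = mat 1" for X
  proof -
    have "?C' ** (?D' ** (?D ** ?C ** X)) = ?C' ** ((?D' ** ?D) ** ?C) ** X"
      by (simp add: matrix_mul_assoc)
    then show "?C' ** (?D' ** (?D ** ?C ** X)) = X"
      using inv by simp
    have "?D ** ?C ** (?C' ** ?D') = ?D ** (?C ** ?C') ** ?D'"
      by (simp add: matrix_mul_assoc)
    then show "?D ** ?C ** (?C' ** ?D') = mat 1"
      using inv by simp
  qed
  have "?D ** ?C ** ?B ** ?A = mat 1 \<longleftrightarrow> ?B ** ?A = ?C' ** ?D'"
  proof
    assume "?D ** ?C ** ?B ** ?A = mat 1"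
    then have "?D ** ?C ** (?B ** ?A) = mat 1"
      by (simp add: matrix_mul_assoc)
    then show "?B ** ?A = ?C' ** ?D'"
      using cancel(1) [of "?B ** ?A"] by simp
  next
    assume "?B ** ?A = ?C' ** ?D'"
    then have "?D ** ?C ** (?B ** ?A) = mat 1"
      using cancel(2) by simp
    then show "?D ** ?C ** ?B ** ?A = mat 1"
      by (simp add: matrix_mul_assoc)
  qed
  also have "\<dots> \<longleftrightarrow> lam = 0 \<or> (a + b + c + d = 0 \<and> a' + b' + c' + d' = 0 \<and> b * a' = c * d' \<and> b' * a = c' * d)"
    unfolding lax_matrix_commute_iff [OF reg]
    by (simp add: diff_conv_add_uminus [symmetric] eq_diff_eq add_ac eq_neg_iff_add_eq_0)
  finally show ?thesis .
qed

text \<open>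
  Put \<open>u = a + c\<close> and \<open>u' = a' + c'\<close>. Substituting \<open>c = u - a\<close>, \<open>c' = u' - a'\<close> into \<open>a a' = c c'\<close> gives
  \<open>u a' = c u'\<close>, and similarly for the other edges: each dual increment is \<open>u' / u\<close> times the
  increment of \<open>z\<close> along the opposite edge. Hence \<open>b a'\<close> and \<open>c d'\<close> both equal \<open>b c u' / u\<close>.
  When \<open>u = 0\<close>, the quadrilateral is a parallelogram and this argument is void; there the dual
  increments are \<open>\<alpha> / a\<close>, \<open>\<beta> / b\<close>, \<open>\<alpha> / c\<close>, \<open>\<beta> / d\<close>, and the claim is the cross-ratio condition itself.
\<close>

lemma dual_quadrilateral:
  fixes a b c d a' b' c' d' :: complex
  assumes closed: "a + b + c + d = 0" "a' + b' + c' + d' = 0"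
    and dual: "a * a' = \<alpha>" "b * b' = \<beta>" "c * c' = \<alpha>" "d * d' = \<beta>"
    and nondeg: "a + c \<noteq> 0 \<or> \<alpha> \<noteq> 0 \<and> \<beta> \<noteq> 0 \<and> (a * c) / (b * d) = \<alpha> / \<beta>"
  shows "b * a' = c * d'" "b' * a = c' * d"
proof -
  have "b * a' = c * d' \<and> b' * a = c' * d"
  proof (cases "a + c = 0")
    case False
    define u u' where "u = a + c" and "u' = a' + c'"
    have c: "c = u - a" "c' = u' - a'" and d: "d = - u - b" "d' = - u' - b'"
      using closed by (auto simp: u_def u'_def algebra_simps eq_neg_iff_add_eq_0)
    have "a * a' = c * c'" "b * b' = d * d'"
      using dual by simp_all
    then have a': "u * a' = c * u'" and b': "u * b' = d * u'"
      unfolding c d by algebra+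
    then have c': "u * c' = a * u'" and d': "u * d' = b * u'"
      unfolding c d by algebra+
    have "u * (b * a') = b * (u * a')" "u * (c * d') = c * (u * d')"
      "u * (b' * a) = (u * b') * a" "u * (c' * d) = (u * c') * d"
      by (simp_all only: ac_simps)
    then have "u * (b * a') = u * (c * d')" "u * (b' * a) = u * (c' * d)"
      unfolding a' b' c' d' by (simp_all only: ac_simps)
    then show ?thesis
      using False by (simp add: u_def)
  next
    case True
    then have nz: "\<alpha> \<noteq> 0" "\<beta> \<noteq> 0" and q: "(a * c) / (b * d) = \<alpha> / \<beta>"
      using nondeg by auto
    have "b \<noteq> 0" "d \<noteq> 0" "a \<noteq> 0" "c \<noteq> 0"
      using dual nz by auto
    then have "a * c * \<beta> = \<alpha> * (b * d)"
      using q nz by (simp add: frac_eq_eq)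
    then have "(a * d) * (b * a') = (a * d) * (c * d')" "(b * c) * (b' * a) = (b * c) * (c' * d)"
      using dual by algebra+
    then show ?thesis
      using \<open>b \<noteq> 0\<close> \<open>d \<noteq> 0\<close> \<open>a \<noteq> 0\<close> \<open>c \<noteq> 0\<close> by simp
  qed
  then show "b * a' = c * d'" "b' * a = c' * d"
    by auto
qed

section \<open>Parallel transport along a flat connection on a lattice\<close>

text \<open>
  Injectivity is what propagates equality to the left of \<open>k0\<close>, and surjectivity is what makes a
  solution extendable there.
\<close>

lemma line_transport_unique:
  fixes u v :: "int \<Rightarrow> 'a"
  assumes inj: "\<And>k. inj (h k)"
    and u: "\<And>k. u (k + 1) = h k (u k)" and v: "\<And>k. v (k + 1) = h k (v k)"
    and base: "u k0 = v k0"
  shows "u k = v k"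
proof (induction k rule: int_induct [where k = k0])
  case base
  show ?case by (rule assms)
next
  case (step1 i)
  then show ?case by (simp add: u v)
next
  case (step2 i)
  have "h (i - 1) (u (i - 1)) = h (i - 1) (v (i - 1))"
    using step2 u [of "i - 1"] v [of "i - 1"] by simp
  then show ?case
    using inj injD by metis
qed

lemma line_transport_exists:
  fixes h :: "int \<Rightarrow> 'a \<Rightarrow> 'a"
  assumes bij: "\<And>k. bij (h k)"
  shows "\<exists>u. u k0 = x \<and> (\<forall>k. u (k + 1) = h k (u k))"
proof -
  define up where "up = rec_nat x (\<lambda>i. h (k0 + int i))"
  define down where "down = rec_nat x (\<lambda>i. inv (h (k0 - int i - 1)))"
  define u where "u k = (if k \<ge> k0 then up (nat (k - k0)) else down (nat (k0 - k)))" for k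
  have "u (k + 1) = h k (u k)" for k
  proof (cases "k \<ge> k0")
    case True
    then have "nat (k + 1 - k0) = Suc (nat (k - k0))"
      by simp
    then show ?thesis
      using True by (simp add: u_def up_def)
  next
    case False
    define i where "i = nat (k0 - k - 1)"
    have k: "k = k0 - int i - 1"
      using False by (simp add: i_def)
    have "h k (down (Suc i)) = down i"
      using bij_is_surj [OF bij] by (simp add: down_def k surj_f_inv_f)
    moreover have "u k = down (Suc i)"
      by (simp add: u_def k nat_add_distrib)
    moreover have "u (k + 1) = down i"
      by (simp add: u_def k up_def down_def)
    ultimately show ?thesis
      by simp
  qed
  moreover have "u k0 = x"
    by (simp add: u_def up_def)
  ultimately show ?thesis
    by blast
qed

text \<open>
  A discrete Poincare lemma. The section is built one direction at a time: once it is known on the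
  sublattice through \<open>p0\<close> spanned by the directions in \<open>A\<close>, it is transported along the lines in a new
  direction \<open>n\<close>. It remains parallel in a direction \<open>m\<close> of \<open>A\<close> because flatness makes both sides of the
  required equation solutions of the same one-step recursion along the \<open>n\<close>-line, with the same value
  on the sublattice.

  The set \<open>A\<close> is part of the statement, and not merely of the induction, because the Lax matrices on
  edges of some types can be singular at a given \<open>\<lambda>\<close>. A contour that avoids these types stays in the
  sublattice spanned by the others.
\<close>

lemma flat_transport_exists:
  fixes T :: "'n::finite \<Rightarrow> int ^ 'n \<Rightarrow> 'a \<Rightarrow> 'a" and p0 :: "int ^ 'n"
  assumes "\<And>n p. n \<in> A \<Longrightarrow> bij (T n p)"
    and "\<And>i j p x. i \<in> A \<Longrightarrow> j \<in> A \<Longrightarrow> i \<noteq> j \<Longrightarrow>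
      T j (p + axis i 1) (T i p x) = T i (p + axis j 1) (T j p x)"
  shows "\<exists>s. s p0 = x0 \<and> (\<forall>p. (\<forall>i. i \<notin> A \<longrightarrow> p $ i = p0 $ i) \<longrightarrow>
      (\<forall>n\<in>A. s (p + axis n 1) = T n p (s p)))"
  using finite [of A] assms
proof (induction A rule: finite_induct)
  case empty
  then show ?case by auto
next
  case (insert n A)
  obtain s where s0: "s p0 = x0"
    and s: "\<And>p m. (\<forall>i. i \<notin> A \<longrightarrow> p $ i = p0 $ i) \<Longrightarrow> m \<in> A \<Longrightarrow> s (p + axis m 1) = T m p (s p)"
    using insert.IH insert.prems by fastforce
  define set_n :: "int ^ 'n \<Rightarrow> int \<Rightarrow> int ^ 'n"
    where "set_n q k = (\<chi> i. if i = n then k else q $ i)" for q k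
  have set_n_shift: "set_n q k + axis n 1 = set_n q (k + 1)"
    "set_n (q + axis n 1) k = set_n q k" for q k
    by (auto simp: set_n_def vec_eq_iff axis_def)
  have set_n_shift': "set_n (q + axis m 1) k = set_n q k + axis m 1" if "m \<in> A" for q k m
    using that insert.hyps by (auto simp: set_n_def vec_eq_iff axis_def)
  have set_n_set_n: "set_n (set_n q l) k = set_n q k" "set_n q (q $ n) = q" for q k l
    by (auto simp: set_n_def vec_eq_iff)
  have "\<exists>u. u (p0 $ n) = s (set_n q (p0 $ n)) \<and> (\<forall>k. u (k + 1) = T n (set_n q k) (u k))" for q
    using insert.prems(1) by (intro line_transport_exists) simp
  then obtain U where U0: "\<And>q. U q (p0 $ n) = s (set_n q (p0 $ n))"
    and U: "\<And>q k. U q (k + 1) = T n (set_n q k) (U q k)"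
    by metis
  \<comment> \<open>\<open>U q\<close> depends only on the \<open>n\<close>-line through \<open>q\<close>, although it was chosen for each \<open>q\<close> separately.\<close>
  have U_cong: "U q k = U q' k" if "\<And>k. set_n q k = set_n q' k" for q q' k
  proof (rule line_transport_unique [where h = "\<lambda>k. T n (set_n q k)" and ?k0.0 = "p0 $ n"])
    show "inj (T n (set_n q k))" for k
      using insert.prems(1) [of n] bij_is_inj by blast
  qed (simp_all add: U U0 that)
  define s' where "s' p = U p (p $ n)" for p
  have "s' (p + axis n 1) = T n p (s' p)" for p
  proof -
    have "s' (p + axis n 1) = U p (p $ n + 1)"
      unfolding s'_def by (simp add: U_cong [OF set_n_shift(2)])
    then show ?thesis
      by (simp add: U s'_def set_n_set_n)
  qed
  moreover have "s' (p + axis m 1) = T m p (s' p)"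
    if p: "\<forall>i. i \<notin> insert n A \<longrightarrow> p $ i = p0 $ i" and m: "m \<in> A" for p m
  proof -
    have "m \<noteq> n"
      using m insert.hyps by auto
    have "U (p + axis m 1) (p $ n) = T m (set_n p (p $ n)) (U p (p $ n))"
    proof (rule line_transport_unique
        [where h = "\<lambda>k. T n (set_n (p + axis m 1) k)" and ?k0.0 = "p0 $ n"
          and v = "\<lambda>k. T m (set_n p k) (U p k)"])
      show "inj (T n (set_n (p + axis m 1) k))" for k
        using insert.prems(1) [of n] bij_is_inj by blast
      show "T m (set_n p (k + 1)) (U p (k + 1))
          = T n (set_n (p + axis m 1) k) (T m (set_n p k) (U p k))" for k
        using insert.prems(2) [of n m "set_n p k" "U p k"] m \<open>m \<noteq> n\<close>
        by (simp add: U set_n_shift set_n_shift')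
      show "U (p + axis m 1) (p0 $ n) = T m (set_n p (p0 $ n)) (U p (p0 $ n))"
        unfolding U0 set_n_shift' [OF m]
        by (rule s [OF _ m]) (use p in \<open>simp add: set_n_def\<close>)
    qed (rule U)
    moreover have "(p + axis m 1) $ n = p $ n"
      using \<open>m \<noteq> n\<close> by (simp add: axis_def)
    ultimately show ?thesis
      by (simp add: s'_def set_n_set_n)
  qed
  moreover have "s' p0 = x0"
    by (simp add: s'_def U0 set_n_set_n s0)
  ultimately show ?case
    by blast
qed

section \<open>Edges and squares of the lattice\<close>

lemma edges_forward: "(p, p + axis n 1) \<in> edges n"
  and edges_backward: "(p + axis n 1, p) \<in> edges n"
  by (auto simp: edges_def)

lemma edges_sym: "(p, q) \<in> edges n \<longleftrightarrow> (q, p) \<in> edges n"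
  by (auto simp: edges_def)

lemma unit_square_edges:
  assumes "unit_square i j p1 p2 p3 p4"
  shows "(p1, p2) \<in> edges i" "(p2, p3) \<in> edges j" "(p3, p4) \<in> edges i" "(p4, p1) \<in> edges j"
  using assms by (auto simp: unit_square_def edges_def algebra_simps)

lemma unit_square_positive:
  "i \<noteq> j \<Longrightarrow> unit_square i j p (p + axis i 1) (p + axis i 1 + axis j 1) (p + axis j 1)"
  by (auto simp: unit_square_def edges_def)

lemma dualityD:
  "duality \<Delta> z zs \<Longrightarrow> (p, q) \<in> edges n \<Longrightarrow> (z q - z p) * (zs q - zs p) = \<Delta> n"
  by (auto simp: duality_def)

lemma dual_square_closed:
  assumes dual: "duality \<Delta> z zs" and sq: "unit_square i j p1 p2 p3 p4"
    and nondeg: "nondegenerate_at \<Delta> z i j p1 p2 p3 p4"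
    and reg: "lam \<in> regular_params (\<Delta> i)" "lam \<in> regular_params (\<Delta> j)"
  shows "lax_matrix (\<Delta> j) (z p1 - z p4) (zs p1 - zs p4) lam
       ** lax_matrix (\<Delta> i) (z p4 - z p3) (zs p4 - zs p3) lam
       ** lax_matrix (\<Delta> j) (z p3 - z p2) (zs p3 - zs p2) lam
       ** lax_matrix (\<Delta> i) (z p2 - z p1) (zs p2 - zs p1) lam = mat 1"
proof -
  note e = unit_square_edges [OF sq]
  note d = e [THEN dualityD [OF dual]]
  have closed: "z p2 - z p1 + (z p3 - z p2) + (z p4 - z p3) + (z p1 - z p4) = 0"
    "zs p2 - zs p1 + (zs p3 - zs p2) + (zs p4 - zs p3) + (zs p1 - zs p4) = 0"
    by simp_all
  have "z p2 - z p1 + (z p4 - z p3) = - (z p1 - z p2 + z p3 - z p4)"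
    by simp
  then have "z p2 - z p1 + (z p4 - z p3) \<noteq> 0 \<or> \<Delta> i \<noteq> 0 \<and> \<Delta> j \<noteq> 0 \<and>
      (z p2 - z p1) * (z p4 - z p3) / ((z p3 - z p2) * (z p1 - z p4)) = \<Delta> i / \<Delta> j"
    using nondeg unfolding nondegenerate_at_def cross_ratio_def by (metis neg_equal_0_iff_equal)
  from dual_quadrilateral [OF closed d this] closed show ?thesis
    unfolding lax_matrix_closed_iff [OF reg d(3,4)] by blast
qed

section \<open>Attached matrices\<close>

lemma attachedD:
  assumes "attached \<Delta> f g L" "e \<in> edges n"
  shows "f e * g e = \<Delta> n"
    and "lam \<in> regular_params (\<Delta> n) \<Longrightarrow> L e lam = lax_matrix (\<Delta> n) (f e) (g e) lam"
    and "lam \<in> regular_params (\<Delta> n) \<Longrightarrow> L (reverse e) lam = matrix_inv (L e lam)"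
  using assms by (auto simp: attached_def)

lemma matrix_inv_eqI:
  fixes A B :: "'a::semiring_1 ^ 'n ^ 'n"
  assumes "A ** B = mat 1" "B ** A = mat 1"
  shows "matrix_inv A = B"
proof -
  have "invertible A"
    using assms by (auto simp: invertible_def)
  then have "matrix_inv A ** A = mat 1"
    unfolding invertible_def matrix_inv_def by (rule someI2_ex) simp
  then have "matrix_inv A ** (A ** B) = B"
    by (simp add: matrix_mul_assoc)
  then show ?thesis
    using assms by simp
qed

text \<open>
  A single such parameter already detects flatness: at \<open>\<lambda> \<noteq> 0\<close> the matrix identity around a square is
  equivalent to conditions free of \<open>\<lambda>\<close>. Any nonzero \<open>\<lambda>\<close> that is small compared with all \<open>\<Delta>\<^sub>n\<close> will do.
\<close>

lemma exists_common_regular_param: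
  fixes \<Delta> :: "'n::finite \<Rightarrow> complex"
  shows "\<exists>lam. lam \<noteq> 0 \<and> (\<forall>n. lam \<in> regular_params (\<Delta> n))"
proof -
  define M where "M = 1 + (\<Sum>n\<in>UNIV. norm (\<Delta> n))"
  have M: "norm (\<Delta> n) < M" for n
    using member_le_sum [of n UNIV "\<lambda>n. norm (\<Delta> n)"] by (simp add: M_def)
  have M1: "M \<ge> 1"
    by (simp add: M_def sum_nonneg)
  have "(complex_of_real (1 / M))\<^sup>2 * \<Delta> n \<noteq> 1" for n
  proof
    assume "(complex_of_real (1 / M))\<^sup>2 * \<Delta> n = 1"
    then have "\<Delta> n = complex_of_real (M\<^sup>2)"
      using M1 by (simp add: field_simps)
    then have "norm (\<Delta> n) = M\<^sup>2"
      using M1 by (simp only: norm_of_real) simp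
    moreover have "M \<le> M\<^sup>2"
      using M1 by (simp add: power2_eq_square)
    ultimately show False
      using M [of n] by simp
  qed
  then show ?thesis
    using M1 by (intro exI [of _ "complex_of_real (1 / M)"]) (simp add: regular_params_def)
qed

text \<open>
  The rule that the reversed edge carries the inverse matrix makes \<open>f\<close> and \<open>g\<close> 1-forms, since inversion
  of a Lax matrix is a change of sign.
\<close>

lemma attached_reverse:
  assumes att: "attached \<Delta> f g L" and e: "(p, q) \<in> edges n"
  shows "f (q, p) = - f (p, q)" "g (q, p) = - g (p, q)"
proof -
  obtain lam where lam: "lam \<noteq> 0" "\<And>n. lam \<in> regular_params (\<Delta> n)"
    using exists_common_regular_param [of \<Delta>] by auto
  have e': "(q, p) \<in> edges n"
    using e edges_sym by blast
  note fg = attachedD(1) [OF att e]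
  have "lax_matrix (\<Delta> n) (f (q, p)) (g (q, p)) lam = L (reverse (p, q)) lam"
    by (simp add: attachedD(2) [OF att e' lam(2)] reverse_def)
  also have "\<dots> = lax_matrix (\<Delta> n) (- f (p, q)) (- g (p, q)) lam"
    unfolding attachedD(3) [OF att e lam(2)] attachedD(2) [OF att e lam(2)]
    by (intro matrix_inv_eqI lax_matrix_inverse lax_matrix_inverse' lam fg)
  finally show "f (q, p) = - f (p, q)" "g (q, p) = - g (p, q)"
    by (simp_all add: lax_matrix_eq_iff [OF lam(2,1)])
qed

lemma zero_curvature_square:
  assumes att: "attached \<Delta> f g L" and flat: "zero_curvature \<Delta> L"
    and sq: "unit_square i j p1 p2 p3 p4"
  shows "f (p1, p2) + f (p2, p3) + f (p3, p4) + f (p4, p1) = 0"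
    "g (p1, p2) + g (p2, p3) + g (p3, p4) + g (p4, p1) = 0"
    "f (p2, p3) * g (p1, p2) = f (p3, p4) * g (p4, p1)"
proof -
  obtain lam where lam: "lam \<noteq> 0" "\<And>n. lam \<in> regular_params (\<Delta> n)"
    using exists_common_regular_param [of \<Delta>] by auto
  note e = unit_square_edges [OF sq]
  let ?es = "[(p1, p2), (p2, p3), (p3, p4), (p4, p1)]"
  have consecutive: "snd (?es ! k) = fst (?es ! ((k + 1) mod length ?es))" if "k < length ?es" for k
  proof -
    from that consider "k = 0" | "k = 1" | "k = 2" | "k = 3"
      by fastforce
    then show ?thesis
      by cases simp_all
  qed
  have "\<forall>e \<in> set ?es. \<exists>n. e \<in> edges n"
    by (use e in simp) blast
  then have "closed_contour ?es"
    unfolding closed_contour_def using consecutive by blast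
  then have "contour_product L lam ?es = mat 1"
    using flat lam(2) unfolding zero_curvature_def by blast
  then have "L (p4, p1) lam ** L (p3, p4) lam ** L (p2, p3) lam ** L (p1, p2) lam = mat 1"
    by (simp add: contour_product_def matrix_mul_assoc)
  note this [unfolded e [THEN attachedD(2) [OF att _ lam(2)]]
      lax_matrix_closed_iff [OF lam(2) lam(2) e(3,4) [THEN attachedD(1) [OF att]]]]
  with lam(1) show "f (p1, p2) + f (p2, p3) + f (p3, p4) + f (p4, p1) = 0"
    "g (p1, p2) + g (p2, p3) + g (p3, p4) + g (p4, p1) = 0"
    "f (p2, p3) * g (p1, p2) = f (p3, p4) * g (p4, p1)"
    by blast+
qed

section \<open>Zero curvature and factorization\<close>

lemma zero_curvature_imp_factorizes:
  assumes att: "attached \<Delta> f g L" and flat: "zero_curvature \<Delta> L"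
  shows "\<exists>z zs. factorizes f g z zs"
proof -
  define T where "T n p x = (fst x + f (p, p + axis n 1), snd x + g (p, p + axis n 1))"
    for n p and x :: "complex \<times> complex"
  have "bij (T n p)" for n p
    by (rule bij_betw_byWitness [where f' = "\<lambda>x. (fst x - f (p, p + axis n 1), snd x - g (p, p + axis n 1))"])
      (auto simp: T_def)
  moreover have "T j (p + axis i 1) (T i p x) = T i (p + axis j 1) (T j p x)" if "i \<noteq> j" for i j p x
  proof -
    let ?q = "p + axis i 1 + axis j 1"
    note sq = zero_curvature_square [OF att flat unit_square_positive [OF that, of p]]
    have q: "?q = p + axis j 1 + axis i 1"
      by (simp add: algebra_simps)
    have r: "f (?q, p + axis j 1) = - f (p + axis j 1, ?q)" "g (?q, p + axis j 1) = - g (p + axis j 1, ?q)"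
      unfolding q by (rule attached_reverse [OF att edges_forward])+
    have r': "f (p + axis j 1, p) = - f (p, p + axis j 1)" "g (p + axis j 1, p) = - g (p, p + axis j 1)"
      by (rule attached_reverse [OF att edges_forward])+
    show ?thesis
      using sq(1,2) unfolding T_def r r' q [symmetric]
      by (simp add: algebra_simps)
  qed
  ultimately have "\<exists>w. w 0 = (0, 0) \<and> (\<forall>p. (\<forall>i. i \<notin> UNIV \<longrightarrow> p $ i = 0 $ i) \<longrightarrow>
      (\<forall>n\<in>UNIV. w (p + axis n 1) = T n p (w p)))"
    by (intro flat_transport_exists)
  then obtain w where w: "\<And>n p. w (p + axis n 1) = T n p (w p)"
    by auto
  have "f (p, q) = fst (w q) - fst (w p) \<and> g (p, q) = snd (w q) - snd (w p)"
    if "(p, q) \<in> edges n" for n p q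
    using that attached_reverse [OF att edges_forward, of q n]
    unfolding edges_def by (auto simp: w T_def)
  then have "factorizes f g (\<lambda>p. fst (w p)) (\<lambda>p. snd (w p))"
    by (auto simp: factorizes_def)
  then show ?thesis
    by blast
qed

lemma factorizes_imp_duality:
  assumes "attached \<Delta> f g L" "factorizes f g z zs"
  shows "duality \<Delta> z zs"
  using assms attachedD(1) [OF assms(1)] unfolding duality_def factorizes_def by fastforce

text \<open>
  With increments as in \<open>zero_curvature_square\<close>:
  \<open>a c \<Delta>\<^sub>j = a c d d' = a d (c d') = a d (b a') = b d \<Delta>\<^sub>i\<close>.
\<close>

lemma zero_curvature_imp_cross_ratio:
  assumes att: "attached \<Delta> f g L" and flat: "zero_curvature \<Delta> L" and fac: "factorizes f g z zs"
    and sq: "unit_square i j p1 p2 p3 p4" and nz: "\<Delta> j \<noteq> 0"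
  shows "cross_ratio (z p1) (z p2) (z p3) (z p4) = \<Delta> i / \<Delta> j"
proof -
  note e = unit_square_edges [OF sq]
  note d = e [THEN attachedD(1) [OF att]]
  note sq = zero_curvature_square(3) [OF att flat sq]
  have f: "f (p1, p2) = z p2 - z p1" "f (p2, p3) = z p3 - z p2" "f (p3, p4) = z p4 - z p3" "f (p4, p1) = z p1 - z p4"
    using fac e unfolding factorizes_def by auto
  have "f (p1, p2) * f (p3, p4) * \<Delta> j = f (p1, p2) * f (p4, p1) * (f (p3, p4) * g (p4, p1))"
    using d(4) by simp
  also have "\<dots> = \<Delta> i * (f (p2, p3) * f (p4, p1))"
    using d(1) sq by (simp flip: sq)
  finally have "f (p1, p2) * f (p3, p4) * \<Delta> j = \<Delta> i * (f (p2, p3) * f (p4, p1))" .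
  moreover have "f (p2, p3) \<noteq> 0" "f (p4, p1) \<noteq> 0"
    using d nz by auto
  ultimately show ?thesis
    using nz unfolding cross_ratio_def f [symmetric] by (simp add: frac_eq_eq)
qed

lemma zero_curvature_imp_cross_ratio_equations:
  assumes "attached \<Delta> f g L" "zero_curvature \<Delta> L" "factorizes f g z zs"
  shows "cross_ratio_equations \<Delta> z"
proof -
  have coords: "(vector [k, l, m] :: vertex) + axis 1 1 = vector [k + 1, l, m]"
    "(vector [k, l, m] :: vertex) + axis 2 1 = vector [k, l + 1, m]"
    "(vector [k, l, m] :: vertex) + axis 3 1 = vector [k, l, m + 1]" for k l m
    by (simp_all add: vec_eq_iff forall_3 axis_def)
  have "unit_square 1 3 (vector [k, l, m]) (vector [k + 1, l, m])
      (vector [k + 1, l, m - 1]) (vector [k, l, m - 1])"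
    "unit_square 3 2 (vector [k, l, m]) (vector [k, l, m + 1])
      (vector [k, l - 1, m + 1]) (vector [k, l - 1, m])"
    "unit_square 2 1 (vector [k, l, m]) (vector [k, l + 1, m])
      (vector [k - 1, l + 1, m]) (vector [k - 1, l, m])" for k l m
    unfolding unit_square_def edges_def
    by (simp_all add: coords) (simp_all add: vec_eq_iff forall_3)
  then show ?thesis
    unfolding cross_ratio_equations_def
    using zero_curvature_imp_cross_ratio [OF assms] by blast
qed

text \<open>
  At a fixed \<open>\<lambda>\<close>, let \<open>A\<close> be the set of edge types at which \<open>\<lambda>\<close> is regular. All edges of the contour have
  types in \<open>A\<close>, so the contour lies in the sublattice through its starting point \<open>p0\<close> in these
  directions, where the frame \<open>\<Phi>\<close> is parallel. Partial products along the contour are the values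
  of \<open>\<Phi>\<close>, and \<open>\<Phi>(p0) = 1\<close>.
\<close>

lemma factorizes_imp_zero_curvature:
  assumes att: "attached \<Delta> f g L" and fac: "factorizes f g z zs" and nondeg: "nondegenerate \<Delta> z"
  shows "zero_curvature \<Delta> L"
  unfolding zero_curvature_def
proof (intro allI impI)
  fix es lam
  assume closed: "closed_contour es"
    and reg: "\<forall>n. \<forall>e\<in>set es. e \<in> edges n \<longrightarrow> lam \<in> regular_params (\<Delta> n)"
  define A where "A = {n. lam \<in> regular_params (\<Delta> n)}"
  define T where "T n p X = L (p, p + axis n 1) lam ** X" for n p and X :: mat2
  have inv: "L (q, p) lam ** L (p, q) lam = mat 1" if "(p, q) \<in> edges n" "n \<in> A" for p q n
  proof -
    have "(q, p) \<in> edges n" "lam \<in> regular_params (\<Delta> n)"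
      using that edges_sym by (auto simp: A_def)
    then show ?thesis
      using that(1) attachedD(1,2) [OF att] attached_reverse [OF att that(1)] lax_matrix_inverse
      by simp
  qed
  have "bij (T n p)" if "n \<in> A" for n p
    by (rule bij_betw_byWitness [where f' = "\<lambda>X. L (p + axis n 1, p) lam ** X"])
      (use inv [OF edges_forward that] inv [OF edges_backward that] in
        \<open>auto simp: T_def matrix_mul_assoc\<close>)
  moreover have "T j (p + axis i 1) (T i p X) = T i (p + axis j 1) (T j p X)"
    if ij: "i \<in> A" "j \<in> A" "i \<noteq> j" for i j p X
  proof -
    let ?q = "p + axis i 1 + axis j 1"
    have sq: "unit_square i j p (p + axis i 1) ?q (p + axis j 1)"
      by (rule unit_square_positive [OF ij(3)])
    note e = unit_square_edges [OF sq]
    have r: "lam \<in> regular_params (\<Delta> i)" "lam \<in> regular_params (\<Delta> j)"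
      using ij by (auto simp: A_def)
    have fg: "f (a, b) = z b - z a" "g (a, b) = zs b - zs a" if "(a, b) \<in> edges n" for a b n
      using fac that by (auto simp: factorizes_def)
    have "L (p + axis j 1, p) lam ** L (?q, p + axis j 1) lam ** L (p + axis i 1, ?q) lam
        ** L (p, p + axis i 1) lam = mat 1"
      using dual_square_closed [OF factorizes_imp_duality [OF att fac] sq _ r] nondeg sq
      by (simp add: nondegenerate_def e(1,3) [THEN attachedD(2) [OF att _ r(1)]]
          e(2,4) [THEN attachedD(2) [OF att _ r(2)]] e [THEN fg(1)] e [THEN fg(2)])
    then have "L (p + axis j 1, ?q) lam ** L (p, p + axis j 1) lam
        ** (L (p + axis j 1, p) lam ** L (?q, p + axis j 1) lam ** L (p + axis i 1, ?q) lam
        ** L (p, p + axis i 1) lam) = L (p + axis j 1, ?q) lam ** L (p, p + axis j 1) lam"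
      by simp
    moreover have "L (p + axis j 1, ?q) lam ** L (p, p + axis j 1) lam
        ** (L (p + axis j 1, p) lam ** L (?q, p + axis j 1) lam ** L (p + axis i 1, ?q) lam
        ** L (p, p + axis i 1) lam)
      = L (p + axis j 1, ?q) lam ** (L (p, p + axis j 1) lam ** L (p + axis j 1, p) lam)
        ** L (?q, p + axis j 1) lam ** (L (p + axis i 1, ?q) lam ** L (p, p + axis i 1) lam)"
      by (simp only: matrix_mul_assoc)
    ultimately have commute: "L (p + axis i 1, ?q) lam ** L (p, p + axis i 1) lam
        = L (p + axis j 1, ?q) lam ** L (p, p + axis j 1) lam"
      using inv [OF e(3) ij(1)] inv [OF e(4) ij(2)] by simp
    have q: "p + axis j 1 + axis i 1 = ?q"
      by (simp add: algebra_simps)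
    have "T j (p + axis i 1) (T i p X) = L (p + axis i 1, ?q) lam ** L (p, p + axis i 1) lam ** X"
      by (simp only: T_def matrix_mul_assoc)
    also have "\<dots> = T i (p + axis j 1) (T j p X)"
      by (simp only: commute T_def matrix_mul_assoc q)
    finally show ?thesis .
  qed
  moreover define p0 where "p0 = fst (es ! 0)"
  ultimately have "\<exists>\<Phi>. \<Phi> p0 = mat 1 \<and> (\<forall>p. (\<forall>i. i \<notin> A \<longrightarrow> p $ i = p0 $ i) \<longrightarrow>
      (\<forall>n\<in>A. \<Phi> (p + axis n 1) = T n p (\<Phi> p)))"
    by (intro flat_transport_exists)
  then obtain \<Phi> where \<Phi>0: "\<Phi> p0 = mat 1"
    and \<Phi>: "\<And>p n. \<forall>i. i \<notin> A \<longrightarrow> p $ i = p0 $ i \<Longrightarrow> n \<in> A \<Longrightarrow>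
      \<Phi> (p + axis n 1) = L (p, p + axis n 1) lam ** \<Phi> p"
    unfolding T_def by blast
  have \<Phi>_edge: "(\<forall>i. i \<notin> A \<longrightarrow> q $ i = p0 $ i) \<and> \<Phi> q = L (p, q) lam ** \<Phi> p"
    if p: "\<forall>i. i \<notin> A \<longrightarrow> p $ i = p0 $ i" and e: "(p, q) \<in> edges n" and n: "n \<in> A" for p q n
  proof -
    have "axis n (1 :: int) $ i = 0" if "i \<notin> A" for i
      using n that by (auto simp: axis_def)
    then have q: "\<forall>i. i \<notin> A \<longrightarrow> q $ i = p0 $ i"
      using p e by (auto simp: edges_def)
    from e consider "q = p + axis n 1" | "p = q + axis n 1"
      by (auto simp: edges_def)
    then have "\<Phi> q = L (p, q) lam ** \<Phi> p"
    proof cases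
      case 1
      then show ?thesis using \<Phi> [OF p n] by simp
    next
      case 2
      then have "L (p, q) lam ** \<Phi> p = L (p, q) lam ** L (q, p) lam ** \<Phi> q"
        using \<Phi> [OF q n] by (simp add: matrix_mul_assoc)
      then show ?thesis
        using inv [OF _ n, of q p] e edges_sym by (metis matrix_mul_lid)
    qed
    with q show ?thesis by blast
  qed
  \<comment> \<open>The index is reduced so that \<open>v (length es)\<close> is again the starting point.\<close>
  define v where "v k = fst (es ! (k mod length es))" for k
  have v_ends: "v 0 = p0" "v (length es) = p0"
    by (simp_all add: v_def p0_def)
  have "(\<forall>i. i \<notin> A \<longrightarrow> v k $ i = p0 $ i) \<and> contour_product L lam (take k es) = \<Phi> (v k)"
    if "k \<le> length es" for k
    using that
  proof (induction k)
    case 0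
    then show ?case
      by (simp add: v_ends contour_product_def \<Phi>0)
  next
    case (Suc k)
    then have k: "k < length es" by simp
    have IH: "\<forall>i. i \<notin> A \<longrightarrow> v k $ i = p0 $ i" "contour_product L lam (take k es) = \<Phi> (v k)"
      using Suc.IH k by auto
    have edge: "es ! k = (v k, v (Suc k))"
      using closed k by (simp add: v_def closed_contour_def prod_eq_iff)
    obtain n where n: "es ! k \<in> edges n" "n \<in> A"
      using closed reg nth_mem [OF k] unfolding closed_contour_def A_def by blast
    note step = \<Phi>_edge [OF IH(1) n(1) [unfolded edge] n(2)]
    have "contour_product L lam (take (Suc k) es) = L (v k, v (Suc k)) lam ** contour_product L lam (take k es)"
      by (simp add: contour_product_def take_Suc_conv_app_nth [OF k] edge)
    then show ?case
      using step unfolding IH(2) by metis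
  qed
  from this [of "length es"] show "contour_product L lam es = mat 1"
    by (simp add: v_ends \<Phi>0)
qed

theorem theorem7p2:
  fixes \<Delta> :: "3 \<Rightarrow> complex"
  shows
    "(\<forall>(z :: vertex \<Rightarrow> complex) (zs :: vertex \<Rightarrow> complex) L i j p1 p2 p3 p4.
        duality \<Delta> z zs \<longrightarrow>
        (\<forall>n. \<forall>(p_out, p_in) \<in> edges n. \<forall>lam \<in> regular_params (\<Delta> n).
           L (p_out, p_in) lam = lax_matrix (\<Delta> n) (z p_in - z p_out) (zs p_in - zs p_out) lam) \<longrightarrow>
        unit_square i j p1 p2 p3 p4 \<longrightarrow> {p1, p2, p3, p4} \<subseteq> QL \<longrightarrow>
        nondegenerate_at \<Delta> z i j p1 p2 p3 p4 \<longrightarrow>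
        (\<forall>lam \<in> regular_params (\<Delta> i) \<inter> regular_params (\<Delta> j).
           L (p4, p1) lam ** L (p3, p4) lam ** L (p2, p3) lam ** L (p1, p2) lam = mat 1))
     \<and>
     (\<forall>(f :: edge \<Rightarrow> complex) (g :: edge \<Rightarrow> complex) L. attached \<Delta> f g L \<longrightarrow>
        (zero_curvature \<Delta> L \<longrightarrow> (\<exists>z zs. factorizes f g z zs)) \<and>
        ((\<forall>z zs. factorizes f g z zs \<longrightarrow> nondegenerate \<Delta> z) \<longrightarrow>
           (zero_curvature \<Delta> L \<longleftrightarrow> (\<exists>z zs. factorizes f g z zs))) \<and>
        (\<forall>z zs. factorizes f g z zs \<longrightarrow> duality \<Delta> z zs) \<and>
        (zero_curvature \<Delta> L \<longrightarrow>
           (\<forall>z zs. factorizes f g z zs \<longrightarrow> cross_ratio_equations \<Delta> z)))"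
proof (intro conjI allI impI ballI)
  fix z zs L i j p1 p2 p3 p4 lam
  assume dual: "duality \<Delta> z zs"
    and L: "\<forall>n. \<forall>(p_out, p_in) \<in> edges n. \<forall>lam \<in> regular_params (\<Delta> n).
      L (p_out, p_in) lam = lax_matrix (\<Delta> n) (z p_in - z p_out) (zs p_in - zs p_out) lam"
    and sq: "unit_square i j p1 p2 p3 p4" and nondeg: "nondegenerate_at \<Delta> z i j p1 p2 p3 p4"
    and lam: "lam \<in> regular_params (\<Delta> i) \<inter> regular_params (\<Delta> j)"
  have L': "L (p, q) lam = lax_matrix (\<Delta> n) (z q - z p) (zs q - zs p) lam"
    if "(p, q) \<in> edges n" "lam \<in> regular_params (\<Delta> n)" for p q n
    using L that by fastforce
  show "L (p4, p1) lam ** L (p3, p4) lam ** L (p2, p3) lam ** L (p1, p2) lam = mat 1"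
    using dual_square_closed [OF dual sq nondeg] unit_square_edges [OF sq, THEN L'] lam by simp
next
  fix f g L z zs
  assume att: "attached \<Delta> f g L"
  show "\<exists>z zs. factorizes f g z zs" if "zero_curvature \<Delta> L"
    using zero_curvature_imp_factorizes [OF att that] .
  show "zero_curvature \<Delta> L \<longleftrightarrow> (\<exists>z zs. factorizes f g z zs)"
    if "\<forall>z zs. factorizes f g z zs \<longrightarrow> nondegenerate \<Delta> z"
    using that zero_curvature_imp_factorizes [OF att] factorizes_imp_zero_curvature [OF att] by blast
  show "duality \<Delta> z zs" if "factorizes f g z zs"
    using factorizes_imp_duality [OF att that] .
  show "cross_ratio_equations \<Delta> z" if "zero_curvature \<Delta> L" "factorizes f g z zs"
    using zero_curvature_imp_cross_ratio_equations [OF att that] .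
qed

end
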